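(* For sets without $6$-term arithmetic progressions in $\mathbb{Z}_6^n$, the following hold in small dimensions: $$r_6(\mathbb{Z}_6^1)=5,\qquad r_6(\mathbb{Z}_6^2)=25,\qquad 116\leq r_6(\mathbb{Z}_6^3)\leq 124.$$
   Context: Here $\mathbb{Z}_m^n := (\mathbb{Z}/m\mathbb{Z})^n$. A $k$-term arithmetic progression is a sequence $a, a+d, a+2d,\dots,a+(k-1)d$ with $a,d\in\mathbb{Z}_m^n$. $r_k(\mathbb{Z}_m^n)$ denotes the maximal size of a set $A\subseteq\mathbb{Z}_m^n$ containing no $k$ distinct elements in arithmetic progression, i.e. no $k$-term arithmetic progression whose $k$ terms are pairwise distinct. *)

theory Defs
  imports "HOL-Algebra.Product_Groups" "HOL-Algebra.Elementary_Groups"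
begin

text \<open>
  The group \<open>(\<int>/m\<int>)\<^sup>n\<close>. The library's \<open>integer_mod_group m\<close> has carrier \<open>{0..<m}\<close> of integers
  for \<open>m > 0\<close>, with addition modulo \<open>m\<close> as the monoid operation; elements of the product are
  functions on the index set \<open>{..<n}\<close>, extended by \<open>undefined\<close>.
\<close>

definition Zmod_pow :: "nat \<Rightarrow> nat \<Rightarrow> (nat \<Rightarrow> int) monoid" where
  "Zmod_pow m n = product_group {..<n} (\<lambda>_. integer_mod_group m)"

text \<open>
  The group operation is written multiplicatively, so this term is \<open>a + i d\<close> in additive notation.
\<close>

definition ap_term :: "('a, 'b) monoid_scheme \<Rightarrow> 'a \<Rightarrow> 'a \<Rightarrow> nat \<Rightarrow> 'a" where
  "ap_term G a d i = a \<otimes>\<^bsub>G\<^esub> (d [^]\<^bsub>G\<^esub> i)"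

definition ap_free :: "('a, 'b) monoid_scheme \<Rightarrow> nat \<Rightarrow> 'a set \<Rightarrow> bool" where
  "ap_free G k A \<longleftrightarrow>
     \<not> (\<exists>a\<in>carrier G. \<exists>d\<in>carrier G.
          inj_on (ap_term G a d) {..<k} \<and> ap_term G a d ` {..<k} \<subseteq> A)"

text \<open>
  The quantity \<open>r\<^sub>k(\<int>\<^sub>m\<^sup>n)\<close>. For \<open>k, m > 0\<close> the maximum ranges over a finite set, which is nonempty
  because the empty set is free of progressions.
\<close>

definition max_ap_free :: "nat \<Rightarrow> nat \<Rightarrow> nat \<Rightarrow> nat" where
  "max_ap_free k m n = Max {card A | A. A \<subseteq> carrier (Zmod_pow m n) \<and> ap_free (Zmod_pow m n) k A}"

end

theory Submission
  imports Defs "HOL-Library.Numeral_Type" "HOL-Library.Product_Plus" "HOL-Number_Theory.Cong"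
begin

text \<open>
  Split \<open>\<int>/6 = \<int>/2 \<times> \<int>/3\<close>. A set \<open>A\<close> becomes a family of \<open>2\<^sup>n\<close> subsets \<open>B x\<close> of the affine space
  \<open>(\<int>/3)\<^sup>n\<close>, and \<open>A\<close> is free of progressions iff every affine line lies in at most one \<open>B x\<close>. Hence
  the numbers of lines contained in the sets \<open>B x\<close> add up to at most the total number of lines,
  namely 1, 12 and 117. The upper bounds follow from linear lower bounds for the number of
  lines in a subset \<open>B\<close>: \<open>card B - 2\<close>, \<open>3 * card B - 16\<close> and \<open>(7 * card B - 80) / 2\<close>.

  The last two come from slicing. Summed over all affine functionals, the second moment of the
  sizes of the slices of \<open>B\<close> depends only on \<open>card B\<close>, and the third moment is an increasing affine
  function of the number of lines in \<open>B\<close>. Slicing a plane into lines, which have at most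
  three points, gives the minimal number of lines in a subset of a plane; slicing the
  space into planes and using this minimum in every plane gives the bound for \<open>n = 3\<close>.
\<close>

section \<open>Progressions modulo 6 and lines modulo 3\<close>

lemma carrier_Zmod_pow: "m > 0 \<Longrightarrow> carrier (Zmod_pow m n) = ({..<n} \<rightarrow>\<^sub>E {0..<int m})"
  by (simp add: Zmod_pow_def carrier_integer_mod_group)

lemma pow_Zmod_pow:
  "d [^]\<^bsub>Zmod_pow m n\<^esub> (k::nat) = (\<lambda>c\<in>{..<n}. (int k * d c) mod int m)"
proof (induction k)
  case 0
  then show ?case by (auto simp: Zmod_pow_def nat_pow_def)
next
  case (Suc k)
  have "d [^]\<^bsub>Zmod_pow m n\<^esub> Suc k = d [^]\<^bsub>Zmod_pow m n\<^esub> k \<otimes>\<^bsub>Zmod_pow m n\<^esub> d"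
    by (simp add: nat_pow_def)
  also have "\<dots> = (\<lambda>c\<in>{..<n}. (int (Suc k) * d c) mod int m)"
    unfolding Suc.IH
    by (auto simp: Zmod_pow_def mod_add_right_eq algebra_simps intro!: restrict_ext)
  finally show ?case .
qed

lemma ap_term_Zmod_pow:
  "ap_term (Zmod_pow m n) a d i = (\<lambda>c\<in>{..<n}. (a c + int i * d c) mod int m)"
  unfolding ap_term_def pow_Zmod_pow
  by (auto simp: Zmod_pow_def mod_add_right_eq intro!: restrict_ext)

section \<open>Chinese remainder splitting of Z/6\<close>

lemma even_mod_6: "even (x mod 6) \<longleftrightarrow> even (x :: int)"
  by presburger

lemma dvd_mod_6_diff:
  fixes x y :: int
  assumes "k dvd 6"
  shows "k dvd x mod 6 - y \<longleftrightarrow> k dvd x - y"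
proof -
  have "k dvd 6 * (x div 6)" using assms by simp
  moreover have "x - y = x mod 6 - y + 6 * (x div 6)" by simp
  ultimately show ?thesis by (metis dvd_add_left_iff)
qed

lemma dvd_mod_6_diff_mod_6:
  fixes x y :: int
  assumes "k dvd 6"
  shows "k dvd x mod 6 - y mod 6 \<longleftrightarrow> k dvd x - y"
  by (metis assms dvd_mod_6_diff dvd_diff_commute)

text \<open>
  For the decomposition \<open>\<int>/6 = \<int>/2 \<times> \<int>/3\<close>: a progression with six distinct terms is a pair of
  points of the first factor times an affine line \<open>{p, q, - p - q}\<close> of the second.
\<close>

definition line_free :: "('x \<times> 'p::ab_group_add) set \<Rightarrow> bool" where
  "line_free C \<longleftrightarrow>
     (\<forall>x y p q. x \<noteq> y \<longrightarrow> p \<noteq> q \<longrightarrow> \<not> {x, y} \<times> {p, q, - p - q} \<subseteq> C)"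

text \<open>Finite types \<open>'x\<close> and \<open>'p\<close> stand for (Z/2)^n and (Z/3)^n, so
  that the three dimensions share one transfer argument. Only equality of parities matters, so
  \<open>'x\<close> is a bare type; lines are written with the group operations of
  \<open>'p\<close>.\<close>

locale Z6_split =
  fixes n :: nat
    and par :: "(nat \<Rightarrow> int) \<Rightarrow> 'x::finite"
    and res :: "(nat \<Rightarrow> int) \<Rightarrow> 'p::{finite, ab_group_add}"
  assumes par_eq_iff: "par u = par v \<longleftrightarrow> (\<forall>c<n. 2 dvd u c - v c)"
    and res_eq_iff: "res u = res v \<longleftrightarrow> (\<forall>c<n. 3 dvd u c - v c)"
    and res_add: "res (\<lambda>c. u c + v c) = res u + res v"
    and card_par: "CARD('x) = 2 ^ n"
    and card_res: "CARD('p) = 3 ^ n"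
begin

abbreviation "Z \<equiv> Zmod_pow 6 n"

definition crt :: "(nat \<Rightarrow> int) \<Rightarrow> 'x \<times> 'p" where
  "crt a = (par a, res a)"

lemma inj_on_crt: "inj_on crt (carrier Z)"
proof (rule inj_onI)
  fix a b assume a: "a \<in> carrier Z" and b: "b \<in> carrier Z" and eq: "crt a = crt b"
  have "a c = b c" if "c < n" for c
  proof -
    have "2 dvd a c - b c" "3 dvd a c - b c"
      using eq that by (auto simp: crt_def par_eq_iff res_eq_iff)
    then have "2 * 3 dvd a c - b c" by (intro divides_mult) simp_all
    then have "a c mod 6 = b c mod 6" by (simp add: mod_eq_dvd_iff)
    moreover have "a c \<in> {0..<6}" "b c \<in> {0..<6}"
      using a b that by (simp_all add: carrier_Zmod_pow PiE_iff)
    ultimately show ?thesis by simp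
  qed
  then show "a = b"
    using a b by (intro PiE_ext[of a "{..<n}"]) (simp_all add: carrier_Zmod_pow)
qed

text \<open>Counting gives surjectivity: \<open>crt\<close> is injective and 6^n = 2^n *
  3^n.\<close>

lemma crt_image_carrier: "crt ` carrier Z = UNIV"
proof (rule card_subset_eq)
  have "card (carrier Z) = 6 ^ n"
    by (simp add: carrier_Zmod_pow card_PiE)
  then show "card (crt ` carrier Z) = CARD('x \<times> 'p)"
    by (simp add: card_image inj_on_crt card_par card_res flip: power_mult_distrib)
qed auto

lemma res_sum_eq_0:
  assumes "\<And>c. c < n \<Longrightarrow> 3 dvd u c + v c + w c"
  shows "res u + res v + res w = 0"
proof -
  have "res u + res v + res w = res (\<lambda>c. u c + v c + w c)"
    by (simp add: res_add)
  also have "\<dots> = res (\<lambda>_. 0)"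
    using assms by (simp add: res_eq_iff)
  also have "\<dots> = 0"
    using res_add[of "\<lambda>_. 0" "\<lambda>_. 0"] by simp
  finally show ?thesis .
qed

text \<open>Modulo 2 a progression alternates between two points; modulo 3 it runs through a line
  with period 3. Six distinct terms make both nondegenerate, and the terms fill the product of the
  point pair and the line.\<close>

lemma ap_free_iff:
  assumes A: "A \<subseteq> carrier Z"
  shows "ap_free Z 6 A \<longleftrightarrow> line_free (crt ` A)"
proof
  assume free: "ap_free Z 6 A"
  show "line_free (crt ` A)"
    unfolding line_free_def
  proof (intro allI impI notI)
    fix x y p q
    assume xy: "x \<noteq> y" and pq: "p \<noteq> q" and sub: "{x, y} \<times> {p, q, - p - q} \<subseteq> crt ` A"
    obtain a where a: "a \<in> A" "crt a = (x, p)" using sub by fastforce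
    obtain b where b: "b \<in> A" "crt b = (y, q)" using sub by fastforce
    \<comment> \<open>Term 0 is to lie over \<open>(x, p)\<close> and term 1 over
      \<open>(y, q)\<close>; this fixes the progression.\<close>
    define d where "d = (\<lambda>c\<in>{..<n}. (b c - a c) mod 6)"
    define t where "t = ap_term Z a d"
    have t: "t i = (\<lambda>c\<in>{..<n}. (a c + int i * (b c - a c)) mod 6)" for i
    proof -
      have "(u + int i * (v mod 6)) mod 6 = (u + int i * v) mod 6" for u v :: int
        by (metis mod_add_right_eq mod_mult_right_eq)
      then show ?thesis
        by (auto simp: t_def ap_term_Zmod_pow d_def intro!: restrict_ext)
    qed
    have tc: "t i \<in> carrier Z" for i
      by (simp add: t carrier_Zmod_pow)
    have dc: "d \<in> carrier Z"
      by (simp add: d_def carrier_Zmod_pow)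
    have par_t: "par (t i) = (if even i then x else y)" for i
    proof (cases "even i")
      case True
      then have "par (t i) = par a"
        by (simp add: par_eq_iff t even_mod_6)
      then show ?thesis using a True by (simp add: crt_def)
    next
      case False
      then have "par (t i) = par b"
        by (auto simp add: par_eq_iff t even_mod_6)
      then show ?thesis using b False by (simp add: crt_def)
    qed
    have res_t: "res (t i) \<in> {p, q, - p - q}" for i
    proof -
      define k where "k = i div 3"
      consider "i = 3 * k" | "i = 3 * k + 1" | "i = 3 * k + 2"
        unfolding k_def by linarith
      then show ?thesis
      proof cases
        case 1
        then have "res (t i) = res a"
          by (simp add: res_eq_iff t dvd_mod_6_diff)
        then show ?thesis using a by (simp add: crt_def)
      next
        case 2
        then have "a c + int i * (b c - a c) - b c = 3 * (int k * (b c - a c))" for c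
          by (simp add: algebra_simps)
        then have "res (t i) = res b"
          by (simp add: res_eq_iff t dvd_mod_6_diff)
        then show ?thesis using b by (simp add: crt_def)
      next
        case 3
        have "3 dvd a c + b c + t i c" if "c < n" for c
        proof -
          \<comment> \<open>Modulo 3, the term a + 2 (b - a) = 2 b - a is - (a + b), the third point
            of the line.\<close>
          have "a c + int i * (b c - a c) - (- (a c + b c)) = 3 * (b c + int k * (b c - a c))"
            using 3 by (simp add: algebra_simps)
          then have "3 dvd a c + int i * (b c - a c) - (- (a c + b c))"
            by (metis dvd_triv_left)
          then have "3 dvd (a c + int i * (b c - a c)) mod 6 - (- (a c + b c))"
            by (subst dvd_mod_6_diff) simp_all
          then show ?thesis using that by (simp add: t algebra_simps)
        qed
        then have "res a + res b + res (t i) = 0" by (rule res_sum_eq_0)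
        then have "res (t i) = - p - q"
          using a b by (simp add: crt_def eq_neg_iff_add_eq_0 algebra_simps)
        then show ?thesis by simp
      qed
    qed
    have "t i \<in> A" for i
    proof -
      have "crt (t i) \<in> crt ` A"
        using sub par_t[of i] res_t[of i] by (auto simp: crt_def)
      then show ?thesis
        using inj_on_image_mem_iff[OF inj_on_crt] A tc by blast
    qed
    moreover have "inj_on t {..<6}"
    proof (rule inj_onI)
      fix i j :: nat assume ij: "i \<in> {..<6}" "j \<in> {..<6}" "t i = t j"
      have 6: "6 dvd (int i - int j) * (b c - a c)" if "c < n" for c
        using fun_cong[OF ij(3), of c] that
        by (simp add: t mod_eq_dvd_iff left_diff_distrib)
      \<comment> \<open>Some coordinate of b - a is odd because \<open>x \<noteq> y\<close>, and
        some is prime to 3 because \<open>p \<noteq> q\<close>; each in turn pushes its prime into i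
        - j.\<close>
      have "2 dvd int i - int j"
      proof (rule ccontr)
        assume *: "\<not> 2 dvd int i - int j"
        have "2 dvd b c - a c" if "c < n" for c
        proof -
          have "2 dvd (int i - int j) * (b c - a c)"
            using 6[OF that] by (rule dvd_trans[rotated]) simp
          then show ?thesis using * by (simp only: even_mult_iff) simp
        qed
        then have "par b = par a" by (simp add: par_eq_iff)
        then show False using a b xy by (simp add: crt_def)
      qed
      moreover have "3 dvd int i - int j"
      proof (rule ccontr)
        assume *: "\<not> 3 dvd int i - int j"
        have "3 dvd b c - a c" if "c < n" for c
        proof -
          have "3 dvd (int i - int j) * (b c - a c)"
            using 6[OF that] by (rule dvd_trans[rotated]) simp
          then show ?thesis using * by (subst (asm) prime_dvd_mult_iff) simp_all
        qed
        then have "res b = res a" by (simp add: res_eq_iff)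
        then show False using a b pq by (simp add: crt_def)
      qed
      ultimately have "2 * 3 dvd int i - int j" by (intro divides_mult) simp_all
      then have "int i mod 6 = int j mod 6" by (simp add: mod_eq_dvd_iff)
      then show "i = j" using ij by simp
    qed
    ultimately show False
      using free a A dc unfolding ap_free_def t_def by blast
  qed
next
  assume free: "line_free (crt ` A)"
  show "ap_free Z 6 A"
    unfolding ap_free_def
  proof (intro notI, elim bexE conjE)
    fix a d
    assume inj: "inj_on (ap_term Z a d) {..<6}" and sub: "ap_term Z a d ` {..<6} \<subseteq> A"
    define t where "t = ap_term Z a d"
    have t: "t i = (\<lambda>c\<in>{..<n}. (a c + int i * d c) mod 6)" for i
      by (simp add: t_def ap_term_Zmod_pow)
    have par_t: "par (t i) = par (t j)" if "even i \<longleftrightarrow> even j" for i j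
      using that by (simp add: par_eq_iff t even_mod_6)
    have res_t: "res (t (i + 3)) = res (t i)" for i
      by (simp add: res_eq_iff t dvd_mod_6_diff_mod_6 algebra_simps)
    have tA: "t i \<in> A" if "i < 6" for i using sub that by (auto simp: t_def)
    have t_neq: "crt (t i) \<noteq> crt (t j)" if "i < 6" "j < 6" "i \<noteq> j" for i j
      using that inj tA A inj_on_crt by (metis t_def inj_on_def lessThan_iff subsetD)
    \<comment> \<open>Terms 0 and 3 agree modulo 3, terms 0 and 2 modulo 2, so each pair differs in
      the other component. Terms 0, 2, 4 trace the line over one parity, terms 3, 5, 1 the same line
      over the other.\<close>
    have "par (t 0) \<noteq> par (t 3)"
      using t_neq[of 0 3] res_t[of 0] by (simp add: crt_def)
    moreover have "res (t 0) \<noteq> res (t 2)"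
      using t_neq[of 0 2] par_t[of 0 2] by (simp add: crt_def)
    moreover have "res (t 0) + res (t 2) + res (t 4) = 0"
    proof (rule res_sum_eq_0)
      fix c assume "c < n"
      then have "3 dvd t 0 c - a c" "3 dvd t 2 c - (a c + 2 * d c)" "3 dvd t 4 c - (a c + 4 * d c)"
        by (simp_all add: t dvd_mod_6_diff)
      then show "3 dvd t 0 c + t 2 c + t 4 c" by presburger
    qed
    then have "res (t 4) = - res (t 0) - res (t 2)" by (simp add: add_eq_0_iff)
    moreover
    have "crt (t 0) = (par (t 0), res (t 0))" "crt (t 2) = (par (t 0), res (t 2))"
      "crt (t 4) = (par (t 0), res (t 4))" "crt (t 3) = (par (t 3), res (t 0))"
      "crt (t 5) = (par (t 3), res (t 2))" "crt (t 1) = (par (t 3), res (t 4))"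
      using par_t[of 0 2] par_t[of 0 4] par_t[of 3 1] par_t[of 3 5] res_t[of 0] res_t[of 1] res_t[of 2]
      by (simp_all add: crt_def)
    moreover have "crt (t i) \<in> crt ` A" if "i < 6" for i using tA that by simp
    from this[of 0] this[of 1] this[of 2] this[of 3] this[of 4] this[of 5]
    have "crt (t 0) \<in> crt ` A" "crt (t 1) \<in> crt ` A" "crt (t 2) \<in> crt ` A"
      "crt (t 3) \<in> crt ` A" "crt (t 4) \<in> crt ` A" "crt (t 5) \<in> crt ` A"
      by simp_all
    ultimately have "{par (t 0), par (t 3)} \<times> {res (t 0), res (t 2), - res (t 0) - res (t 2)} \<subseteq> crt ` A"
      by simp
    with \<open>par (t 0) \<noteq> par (t 3)\<close> \<open>res (t 0) \<noteq> res (t 2)\<close> show False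
      using free unfolding line_free_def by metis
  qed
qed

lemma max_ap_free_eq: "max_ap_free 6 6 n = Max {card C | C :: ('x \<times> 'p) set. line_free C}"
proof -
  have "{card A | A. A \<subseteq> carrier Z \<and> ap_free Z 6 A} = {card C | C :: ('x \<times> 'p) set. line_free C}"
    (is "?L = ?R")
  proof (intro equalityI subsetI)
    fix k assume "k \<in> ?L"
    then obtain A where A: "A \<subseteq> carrier Z" "ap_free Z 6 A" "k = card A" by blast
    then have "card (crt ` A) = k" "line_free (crt ` A)"
      using ap_free_iff[OF A(1)] card_image[OF inj_on_subset[OF inj_on_crt A(1)]] by simp_all
    then show "k \<in> ?R" by blast
  next
    fix k assume "k \<in> ?R"
    then obtain C :: "('x \<times> 'p) set" where C: "line_free C" "k = card C" by blast
    obtain A where A: "A \<subseteq> carrier Z" "crt ` A = C"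
      using crt_image_carrier by (metis subset_UNIV subset_imageE)
    then have "card A = k" "ap_free Z 6 A"
      using C ap_free_iff[OF A(1)] card_image[OF inj_on_subset[OF inj_on_crt A(1)]] by simp_all
    then show "k \<in> ?L" using A by blast
  qed
  then show ?thesis by (simp add: max_ap_free_def)
qed

lemma max_ap_free_le:
  assumes "\<And>C :: ('x \<times> 'p) set. line_free C \<Longrightarrow> card C \<le> b"
  shows "max_ap_free 6 6 n \<le> b"
proof -
  have "line_free ({} :: ('x \<times> 'p) set)" by (simp add: line_free_def)
  then show ?thesis
    unfolding max_ap_free_eq using assms by (subst Max_le_iff) auto
qed

lemma max_ap_free_ge:
  assumes "line_free (C :: ('x \<times> 'p) set)"
  shows "card C \<le> max_ap_free 6 6 n"
  unfolding max_ap_free_eq using assms by (intro Max_ge) auto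

end

section \<open>Slices of subsets of the affine space\<close>

lemma UNIV_3: "(UNIV :: 3 set) = {0, 1, 2}"
  by (rule sym, rule card_subset_eq) simp_all

lemma all_3: "(\<forall>x::3. P x) \<longleftrightarrow> P 0 \<and> P 1 \<and> P 2"
proof -
  have "(\<forall>x::3. P x) \<longleftrightarrow> (\<forall>x\<in>UNIV. P x)" by simp
  then show ?thesis unfolding UNIV_3 by simp
qed

lemma sum_3: "(\<Sum>x\<in>UNIV. f (x::3)) = f 0 + f 1 + (f 2 :: 'a::comm_monoid_add)"
  unfolding UNIV_3 by (simp add: add.assoc)

lemma sum_UNIV_prod:
  "(\<Sum>x\<in>UNIV. f (x :: 'a::finite \<times> 'b::finite)) = (\<Sum>a\<in>UNIV. \<Sum>b\<in>UNIV. f (a, b))"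
  by (simp add: sum.cartesian_product)

lemma of_int_3: "of_int u = (of_int v :: 3) \<longleftrightarrow> 3 dvd u - v"
  by (simp add: of_int_eq_iff_cong_CHAR cong_iff_dvd_diff)

lemma triple_3: "x + x + x = (0::3)"
proof -
  have "x + x + x = 3 * x" by simp
  also have "(3::3) = 0" by simp
  finally show ?thesis by simp
qed

lemma minus_double: "x + x + x = 0 \<Longrightarrow> - x - x = (x :: 'a::ab_group_add)"
  by (metis add.assoc add_eq_0_iff diff_conv_add_uminus minus_add_distrib minus_minus)

section \<open>Linear functionals on (Z/3)^3\<close>

type_synonym F33 = "3 \<times> 3 \<times> 3"

lemma triple_F33: "x + x + x = (0 :: F33)"
  using triple_3 by (cases x) (simp add: zero_prod_def)

lemma minus_double_F33: "- x - x = (x :: F33)"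
  by (rule minus_double) (rule triple_F33)

fun dot :: "F33 \<Rightarrow> F33 \<Rightarrow> 3" where
  "dot (a, b, c) (x, y, z) = a * x + b * y + c * z"

lemma dot_commute: "dot c u = dot u c"
  by (cases c; cases u) (simp add: mult.commute)

lemma dot_add: "dot c (u + v) = dot c u + dot c v"
  by (cases c; cases u; cases v) (simp add: algebra_simps)

lemma dot_diff: "dot c (u - v) = dot c u - dot c v"
  by (cases c; cases u; cases v) (simp add: algebra_simps)

lemma dot_uminus: "dot c (- u) = - dot c u"
  by (cases c; cases u) (simp add: algebra_simps)

lemma dot_zero: "dot 0 u = 0"
  by (cases u) (simp add: zero_prod_def)

lemma dot_uminus_left: "dot (- c) u = - dot c u"
  by (cases c; cases u) (simp add: algebra_simps)

lemma card_dot_eq_0: "(\<Sum>c\<in>UNIV. of_bool (dot c u = 0)) = (9 + 18 * of_bool (u = 0) :: int)"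
proof -
  have "\<forall>u1 u2 u3. (\<Sum>c\<in>UNIV. of_bool (dot c (u1, u2, u3) = 0)) =
    (9 + 18 * of_bool ((u1, u2, u3) = 0) :: int)"
    unfolding sum_UNIV_prod sum_3 all_3 by (simp add: zero_prod_def)
  then show ?thesis by (cases u) blast
qed

text \<open>Up to sign these are the four nonzero functionals on (Z/3)^2: a nonzero point is killed
  by exactly one of them, the origin by all four.\<close>

lemma of_bool_both_eq_0:
  fixes x y :: 3
  shows "3 * of_bool (x = 0 \<and> y = 0) =
    (of_bool (x = 0) + of_bool (y = 0) + of_bool (x + y = 0) + of_bool (x - y = 0) - 1 :: int)"
proof -
  have "\<forall>x y :: 3. 3 * of_bool (x = 0 \<and> y = 0) =
    (of_bool (x = 0) + of_bool (y = 0) + of_bool (x + y = 0) + of_bool (x - y = 0) - 1 :: int)"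
    unfolding all_3 by simp
  then show ?thesis by blast
qed

text \<open>Summing \<open>of_bool_both_eq_0\<close> over \<open>c\<close> reduces to single
  vectors. The indicators list the dependences between \<open>u\<close> and \<open>v\<close>: none
  holds in rank 2, one in rank 1, all four in rank 0.\<close>

lemma card_dot_both_eq_0:
  "(\<Sum>c\<in>UNIV. of_bool (dot c u = 0 \<and> dot c v = 0)) =
    (3 + 6 * (of_bool (u = 0) + of_bool (v = 0) + of_bool (u + v = 0) + of_bool (u = v)) :: int)"
proof -
  have "3 * (\<Sum>c\<in>UNIV. of_bool (dot c u = 0 \<and> dot c v = 0) :: int) =
      (\<Sum>c\<in>UNIV. of_bool (dot c u = 0) + of_bool (dot c v = 0) + of_bool (dot c (u + v) = 0)
        + of_bool (dot c (u - v) = 0) - 1)"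
    unfolding sum_distrib_left of_bool_both_eq_0 dot_add dot_diff ..
  also have "\<dots> = 9 + 18 * of_bool (u = 0) + (9 + 18 * of_bool (v = 0))
      + (9 + 18 * of_bool (u + v = 0)) + (9 + 18 * of_bool (u - v = 0)) - 27"
    unfolding sum.distrib sum_subtractf card_dot_eq_0 by simp
  finally show ?thesis by simp
qed

text \<open>For \<open>c \<noteq> 0\<close> these are the cuts by three parallel planes, and
  \<open>- c\<close> gives the same planes; \<open>c = 0\<close> gives \<open>B\<close> and two
  empty sets.\<close>

definition slice :: "F33 set \<Rightarrow> F33 \<Rightarrow> 3 \<Rightarrow> F33 set" where
  "slice B c k = {p \<in> B. dot c p = k}"

text \<open>
  In a group of exponent 3 a triple of points sums to zero iff it is constant or an ordered affine
  line, so \<open>zero_sums B\<close> has \<open>card B\<close> elements plus six for each line contained in \<open>B\<close>.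
\<close>

definition zero_sums :: "'p::ab_group_add set \<Rightarrow> ('p \<times> 'p) set" where
  "zero_sums B = {(p, q). p \<in> B \<and> q \<in> B \<and> - p - q \<in> B}"

section \<open>Moments of the slice sizes\<close>

lemma card_slice: "int (card (slice B c k)) = (\<Sum>p\<in>B. of_bool (dot c p = k))"
proof -
  have "slice B c k = B \<inter> {p. dot c p = k}" by (auto simp: slice_def)
  then show ?thesis by (simp add: sum_of_bool_eq)
qed

lemma sum_of_bool_common_value:
  "(\<Sum>k\<in>UNIV. of_bool (x = k) * of_bool (y = k) * of_bool (z = k)) =
    (of_bool (y - x = 0 \<and> z - x = 0) :: int)" for x y z :: "'a::{finite, ab_group_add}"
proof -
  have "(\<Sum>k\<in>UNIV. of_bool (x = k) * of_bool (y = k) * of_bool (z = k)) =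
      (\<Sum>k\<in>UNIV. if k = x then of_bool (y - x = 0 \<and> z - x = 0) else (0 :: int))"
    by (intro sum.cong) auto
  then show ?thesis by simp
qed

text \<open>A functional is constant on the three points iff it kills q - p and r - p. Since 3 p =
  0, the dependence (q - p) + (r - p) = 0 reads \<open>r = - p - q\<close>: here lines enter the
  third moment.\<close>

lemma sum_common_value:
  "(\<Sum>c\<in>UNIV. \<Sum>k\<in>UNIV. of_bool (dot c p = k) * of_bool (dot c q = k) * of_bool (dot c r = k)) =
    (3 + 6 * (of_bool (p = q) + of_bool (p = r) + of_bool (r = - p - q) + of_bool (q = r)) :: int)"
proof -
  have "(\<Sum>c\<in>UNIV. \<Sum>k\<in>UNIV. of_bool (dot c p = k) * of_bool (dot c q = k) * of_bool (dot c r = k)) =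
      (\<Sum>c\<in>UNIV. of_bool (dot c (q - p) = 0 \<and> dot c (r - p) = 0) :: int)"
    unfolding sum_of_bool_common_value dot_diff ..
  also have "\<dots> = 3 + 6 * (of_bool (q - p = 0) + of_bool (r - p = 0) + of_bool (q - p + (r - p) = 0)
      + of_bool (q - p = r - p))"
    by (rule card_dot_both_eq_0)
  also have "q - p + (r - p) = r - (- p - q)"
    using triple_F33[of p] by (simp add: algebra_simps)
  also have "q - p = 0 \<longleftrightarrow> p = q" by auto
  also have "r - p = 0 \<longleftrightarrow> p = r" by auto
  also have "r - (- p - q) = 0 \<longleftrightarrow> r = - p - q" by (rule right_minus_eq)
  also have "q - p = r - p \<longleftrightarrow> q = r" by simp
  finally show ?thesis .
qed

lemma sum_common_value_pair:
  "(\<Sum>c\<in>UNIV. \<Sum>k\<in>UNIV. of_bool (dot c p = k) * of_bool (dot c q = k)) =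
    (9 + 18 * of_bool (p = q) :: int)"
proof -
  have "(\<Sum>c\<in>UNIV. \<Sum>k\<in>UNIV. of_bool (dot c p = k) * of_bool (dot c q = k)) =
    (\<Sum>c\<in>UNIV. \<Sum>k\<in>UNIV. of_bool (dot c p = k) * of_bool (dot c q = k) * of_bool (dot c q = k) :: int)"
    by (simp add: mult.assoc)
  also have "\<dots> = 9 + 18 * of_bool (p = q)"
    unfolding sum_common_value using minus_double_F33[of q]
    by (cases "p = q") (auto simp: algebra_simps)
  finally show ?thesis .
qed

lemma card_zero_sums:
  assumes "finite B"
  shows "(\<Sum>p\<in>B. \<Sum>q\<in>B. of_bool (- p - q \<in> B)) = int (card (zero_sums B))"
proof -
  have "zero_sums B = Sigma B (\<lambda>p. B \<inter> {q. - p - q \<in> B})"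
    by (auto simp: zero_sums_def)
  then show ?thesis
    using assms by (simp add: sum_of_bool_eq)
qed

text \<open>The cube counts triples of \<open>B\<close> in a common slice. After exchanging sums,
  the three coincidences of two points yield the square term and collinearity yields
  \<open>zero_sums\<close>.\<close>

lemma sum_slice_cube:
  "(\<Sum>c\<in>UNIV. \<Sum>k\<in>UNIV. int (card (slice B c k)) ^ 3) =
    3 * int (card B) ^ 3 + 18 * int (card B) ^ 2 + 6 * int (card (zero_sums B))"
proof -
  let ?e = "\<lambda>p c k. of_bool (dot c p = k) :: int"
  have fin: "finite B" by simp
  have swap: "(\<Sum>x\<in>UNIV. \<Sum>p\<in>B. g x p) = (\<Sum>p\<in>B. \<Sum>x\<in>UNIV. g x p)"
    for g :: "'z::finite \<Rightarrow> F33 \<Rightarrow> int"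
    by (rule sum.swap)
  have "int (card (slice B c k)) ^ 3 = (\<Sum>p\<in>B. \<Sum>q\<in>B. \<Sum>r\<in>B. ?e p c k * ?e q c k * ?e r c k)" for c k
    unfolding card_slice power3_eq_cube by (simp only: flip: sum_distrib_left sum_distrib_right)
  then have "(\<Sum>c\<in>UNIV. \<Sum>k\<in>UNIV. int (card (slice B c k)) ^ 3) =
      (\<Sum>p\<in>B. \<Sum>q\<in>B. \<Sum>r\<in>B. \<Sum>c\<in>UNIV. \<Sum>k\<in>UNIV. ?e p c k * ?e q c k * ?e r c k)"
    by (simp only: swap)
  also have "\<dots> = (\<Sum>p\<in>B. \<Sum>q\<in>B. \<Sum>r\<in>B.
      3 + 6 * (of_bool (p = q) + of_bool (p = r) + of_bool (r = - p - q) + of_bool (q = r)))"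
    unfolding sum_common_value ..
  also have "\<dots> = (\<Sum>p\<in>B. \<Sum>q\<in>B. 3 * int (card B) +
      6 * (int (card B) * of_bool (p = q) + 2 + of_bool (- p - q \<in> B)))"
    using fin by (intro sum.cong refl)
      (simp add: sum.distrib of_bool_def flip: sum_distrib_left)
  also have "\<dots> = 3 * int (card B) ^ 3 + 18 * int (card B) ^ 2 + 6 * int (card (zero_sums B))"
    using fin card_zero_sums[OF fin, symmetric]
    by (simp add: sum.distrib of_bool_def power2_eq_square power3_eq_cube algebra_simps
        flip: sum_distrib_left)
  finally show ?thesis .
qed

lemma sum_slice_square:
  "(\<Sum>c\<in>UNIV. \<Sum>k\<in>UNIV. int (card (slice B c k)) ^ 2) =
    9 * int (card B) ^ 2 + 18 * int (card B)"
proof -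
  let ?e = "\<lambda>p c k. of_bool (dot c p = k) :: int"
  have fin: "finite B" by simp
  have swap: "(\<Sum>x\<in>UNIV. \<Sum>p\<in>B. g x p) = (\<Sum>p\<in>B. \<Sum>x\<in>UNIV. g x p)"
    for g :: "'z::finite \<Rightarrow> F33 \<Rightarrow> int"
    by (rule sum.swap)
  have "int (card (slice B c k)) ^ 2 = (\<Sum>p\<in>B. \<Sum>q\<in>B. ?e p c k * ?e q c k)" for c k
    unfolding card_slice power2_eq_square sum_product ..
  then have "(\<Sum>c\<in>UNIV. \<Sum>k\<in>UNIV. int (card (slice B c k)) ^ 2) =
      (\<Sum>p\<in>B. \<Sum>q\<in>B. \<Sum>c\<in>UNIV. \<Sum>k\<in>UNIV. ?e p c k * ?e q c k)"
    by (simp only: swap)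
  also have "\<dots> = (\<Sum>p\<in>B. \<Sum>q\<in>B. 9 + 18 * of_bool (p = q))"
    unfolding sum_common_value_pair ..
  also have "\<dots> = 9 * int (card B) ^ 2 + 18 * int (card B)"
    using fin
    by (simp add: sum.distrib of_bool_def power2_eq_square flip: sum_distrib_left)
      (simp add: algebra_simps)
  finally show ?thesis .
qed

text \<open>If \<open>p\<close> and \<open>q\<close> lie in one slice, so does
  \<open>- p - q\<close>, because - k - k = k; hence pairs suffice. The diagonal pairs contribute
  the term in \<open>card B\<close>.\<close>

lemma sum_zero_sums_slice:
  "(\<Sum>c\<in>UNIV. \<Sum>k\<in>UNIV. int (card (zero_sums (slice B c k)))) =
    9 * int (card (zero_sums B)) + 18 * int (card B)"
proof -
  let ?e = "\<lambda>p c k. of_bool (dot c p = k) :: int"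
  have fin: "finite (zero_sums B)" by simp
  have swap: "(\<Sum>x\<in>UNIV. \<Sum>p\<in>zero_sums B. g x p) = (\<Sum>p\<in>zero_sums B. \<Sum>x\<in>UNIV. g x p)"
    for g :: "'z::finite \<Rightarrow> F33 \<times> F33 \<Rightarrow> int"
    by (rule sum.swap)
  have "int (card (zero_sums (slice B c k))) = (\<Sum>x\<in>zero_sums B. ?e (fst x) c k * ?e (snd x) c k)" for c k
  proof -
    have "- k - k = k" by (rule minus_double) (rule triple_3)
    then have "zero_sums (slice B c k) = zero_sums B \<inter> {x. dot c (fst x) = k \<and> dot c (snd x) = k}"
      by (auto simp: zero_sums_def slice_def dot_diff dot_uminus)
    then show ?thesis using fin by (simp add: sum_of_bool_eq flip: of_bool_conj)
  qed
  then have "(\<Sum>c\<in>UNIV. \<Sum>k\<in>UNIV. int (card (zero_sums (slice B c k)))) =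
      (\<Sum>x\<in>zero_sums B. \<Sum>c\<in>UNIV. \<Sum>k\<in>UNIV. ?e (fst x) c k * ?e (snd x) c k)"
    by (simp only: swap)
  also have "\<dots> = (\<Sum>x\<in>zero_sums B. 9 + 18 * of_bool (fst x = snd x))"
    unfolding sum_common_value_pair ..
  also have "\<dots> = 9 * int (card (zero_sums B)) + 18 * int (card (zero_sums B \<inter> {x. fst x = snd x}))"
    using fin by (simp add: sum.distrib sum_of_bool_eq flip: sum_distrib_left)
  also have "zero_sums B \<inter> {x. fst x = snd x} = (\<lambda>p. (p, p)) ` B"
  proof (rule Set.set_eqI)
    fix x :: "F33 \<times> F33"
    obtain p q where x: "x = (p, q)" by (rule prod.exhaust)
    have "x \<in> zero_sums B \<inter> {x. fst x = snd x} \<longleftrightarrow> p = q \<and> p \<in> B"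
      by (auto simp: x zero_sums_def minus_double_F33)
    also have "\<dots> \<longleftrightarrow> x \<in> (\<lambda>p. (p, p)) ` B"
      unfolding x by blast
    finally show "x \<in> zero_sums B \<inter> {x. fst x = snd x} \<longleftrightarrow> x \<in> (\<lambda>p. (p, p)) ` B" .
  qed
  also have "card \<dots> = card B"
    by (rule card_image) (simp add: inj_on_def)
  finally show ?thesis .
qed

section \<open>Slice sizes and lines in a plane\<close>

lemma card_slice_le:
  assumes "c \<noteq> 0"
  shows "card (slice B c k) \<le> 9"
proof (cases "slice B c k = {}")
  case False
  then obtain p where p: "dot c p = k" by (auto simp: slice_def)
  have "int (card {u. dot c u = 0}) = 9"
    using card_dot_eq_0[of c] assms by (simp add: dot_commute[of _ c] sum_of_bool_eq)
  moreover have "card (slice B c k) = card ((\<lambda>q. q - p) ` slice B c k)"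
    by (rule card_image [symmetric]) (simp add: inj_on_def)
  moreover have "\<dots> \<le> card {u. dot c u = 0}"
    by (rule card_mono) (use p in \<open>simp_all add: slice_def dot_diff image_subset_iff\<close>)
  ultimately show ?thesis by simp
qed simp

text \<open>The functionals are independent, so their common kernel has 3 points, and a translation
  moves the double slice into it.\<close>

lemma card_slice_slice_le:
  assumes "d \<noteq> 0" "c \<notin> {0, d, - d}"
  shows "card (slice (slice B d l) c k) \<le> 3"
proof (cases "slice (slice B d l) c k = {}")
  case False
  then obtain p where p: "dot c p = k" "dot d p = l" by (auto simp: slice_def)
  have "int (card {u. dot c u = 0 \<and> dot d u = 0}) = 3"
    using card_dot_both_eq_0[of c d] assms
    by (simp add: dot_commute[of _ c] dot_commute[of _ d] sum_of_bool_eq add_eq_0_iff2)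
  moreover have "card (slice (slice B d l) c k) = card ((\<lambda>q. q - p) ` slice (slice B d l) c k)"
    by (rule card_image [symmetric]) (simp add: inj_on_def)
  moreover have "\<dots> \<le> card {u. dot c u = 0 \<and> dot d u = 0}"
    by (rule card_mono) (use p in \<open>simp_all add: slice_def dot_diff image_subset_iff\<close>)
  ultimately show ?thesis by simp
qed simp

lemma sum_card_slices:
  "card (slice B c 0) + card (slice B c 1) + card (slice B c 2) = card B"
proof -
  have "card B = (\<Sum>k\<in>UNIV. card (slice B c k))"
    unfolding slice_def by (subst card_eq_sum, subst sum.group[where g = "dot c" and T = UNIV, symmetric])
      (simp_all flip: card_eq_sum)
  then show ?thesis by (simp add: sum_3)
qed

lemma card_le_zero_sums:
  fixes B :: "'p::{finite, ab_group_add} set"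
  assumes "\<And>x :: 'p. x + x + x = 0"
  shows "card B \<le> card (zero_sums B)"
proof -
  have "card B = card ((\<lambda>p. (p, p)) ` B)"
    by (rule card_image [symmetric]) (simp add: inj_on_def)
  also have "\<dots> \<le> card (zero_sums B)"
    by (rule card_mono) (simp_all add: zero_sums_def image_subset_iff minus_double assms)
  finally show ?thesis .
qed

text \<open>Each of the 24 functionals that are not constant on the plane cuts it into three lines.\<close>

lemma zero_sums_plane_bound:
  assumes "d \<noteq> 0" and b: "int (card (slice B d l)) = b"
    and bound: "\<And>s0 s1 s2 :: nat. s0 \<le> 3 \<Longrightarrow> s1 \<le> 3 \<Longrightarrow> s2 \<le> 3 \<Longrightarrow> int (s0 + s1 + s2) = b \<Longrightarrow>
      \<alpha> + \<gamma> * (int s0 ^ 2 + int s1 ^ 2 + int s2 ^ 2) \<le> m * (int s0 ^ 3 + int s1 ^ 3 + int s2 ^ 3)"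
  shows "24 * \<alpha> + \<gamma> * (6 * b ^ 2 + 18 * b) \<le> m * (18 * b ^ 2 + 6 * int (card (zero_sums (slice B d l))))"
proof -
  define P where "P = slice B d l"
  let ?S = "\<lambda>j c. \<Sum>k\<in>UNIV. int (card (slice P c k)) ^ j"
  \<comment> \<open>These three functionals are constant on the plane, so one slice is all of
    \<open>P\<close>.\<close>
  have par: "?S j c = b ^ j" if "c \<in> {0, d, - d}" "j > 0" for c j
  proof -
    define k0 where "k0 = (if c = 0 then 0 else if c = d then l else - l)"
    have "dot c p = k0" if "p \<in> P" for p
      using that \<open>c \<in> {0, d, - d}\<close>
      by (auto simp: k0_def P_def slice_def dot_zero dot_uminus_left)
    then have "slice P c k = (if k = k0 then P else {})" for k
      by (simp add: slice_def) blast
    then have "int (card (slice P c k)) ^ j = (if k = k0 then b ^ j else 0)" for k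
      using that b by (simp add: P_def)
    then show ?thesis by simp
  qed
  have d: "- d \<noteq> d"
  proof
    assume "- d = d"
    then have "d + d + d = - d + d + d" by simp
    with triple_F33[of d] assms(1) show False by simp
  qed
  have split: "(\<Sum>c\<in>UNIV. ?S j c) = 3 * b ^ j + (\<Sum>c\<in>- {0, d, - d}. ?S j c)" if "j > 0" for j
  proof -
    have "(\<Sum>c\<in>UNIV. ?S j c) = (\<Sum>c\<in>{0, d, - d}. ?S j c) + (\<Sum>c\<in>- {0, d, - d}. ?S j c)"
      by (subst sum.union_disjoint [symmetric]) (simp_all add: Compl_partition)
    also have "(\<Sum>c\<in>{0, d, - d}. ?S j c) = (\<Sum>c\<in>{0, d, - d}. b ^ j)"
      by (rule sum.cong) (simp_all only: par that)
    also have "\<dots> = 3 * b ^ j" using d assms(1) by simp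
    finally show ?thesis .
  qed
  have "card (- {0, d, - d}) = 24"
    using d assms(1) by (simp add: Compl_eq_Diff_UNIV card_Diff_subset)
  then have "24 * \<alpha> + \<gamma> * (\<Sum>c\<in>- {0, d, - d}. ?S 2 c) = (\<Sum>c\<in>- {0, d, - d}. \<alpha> + \<gamma> * ?S 2 c)"
    by (simp add: sum.distrib sum_distrib_left)
  also have "\<dots> \<le> (\<Sum>c\<in>- {0, d, - d}. m * ?S 3 c)"
  proof (rule sum_mono)
    fix c assume "c \<in> - {0, d, - d}"
    then have "card (slice P c k) \<le> 3" for k
      unfolding P_def using assms(1) by (intro card_slice_slice_le) auto
    then show "\<alpha> + \<gamma> * ?S 2 c \<le> m * ?S 3 c"
      using bound[of "card (slice P c 0)" "card (slice P c 1)" "card (slice P c 2)"] b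
      by (simp only: sum_card_slices sum_3 P_def[symmetric])
  qed
  also have "\<dots> = m * (\<Sum>c\<in>- {0, d, - d}. ?S 3 c)"
    by (simp add: sum_distrib_left)
  \<comment> \<open>Removing 3 b^j from the full moments leaves 6 b^2 + 18 b and 18 b^2 + 6 T, where
    T is the size of \<open>zero_sums P\<close>.\<close>
  finally show ?thesis
    using split[of 2] split[of 3] sum_slice_square[of P] sum_slice_cube[of P] b
    by (simp add: P_def)
qed

text \<open>
  \<open>s\<close> points of an affine plane over \<open>\<int>/3\<close> contain at least
  \<open>(min_zero_sums s - s) / 6\<close> lines.
\<close>

definition min_zero_sums :: "nat \<Rightarrow> int" where
  "min_zero_sums s = [0, 1, 2, 3, 4, 11, 18, 37, 56, 81] ! s"

text \<open>Up to four points the constant triples suffice. For 5 to 9 points the multipliers are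
  valid for every split into three parallel lines of at most 3 points, and averaging them gives
  exactly the table entry.\<close>

lemma min_zero_sums_le:
  assumes "d \<noteq> 0"
  shows "min_zero_sums (card (slice B d l)) \<le> int (card (zero_sums (slice B d l)))"
proof -
  define b where "b = card (slice B d l)"
  have le3: "s = 0 \<or> s = 1 \<or> s = 2 \<or> s = 3" if "s \<le> 3" for s :: nat
    using that by linarith
  have "b \<le> 4 \<or> b = 5 \<or> b = 6 \<or> b = 7 \<or> b = 8 \<or> b = 9"
    using card_slice_le[OF assms, of B l] by (auto simp: b_def)
  then consider "b \<le> 4" | "b = 5" | "b = 6" | "b = 7" | "b = 8" | "b = 9"
    by blast
  then show ?thesis
  proof cases
    case 1
    then have "min_zero_sums b = int b"
      by (cases "b = 0 \<or> b = 1 \<or> b = 2 \<or> b = 3 \<or> b = 4") (auto simp: min_zero_sums_def)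
    then show ?thesis
      using card_le_zero_sums[OF triple_F33, of "slice B d l"] by (simp add: b_def)
  next
    case 2
    show ?thesis
      using zero_sums_plane_bound[OF assms, of B l 5 "- 47" 9 2] 2
      by (fastforce dest!: le3 simp: b_def min_zero_sums_def)
  next
    case 3
    show ?thesis
      using zero_sums_plane_bound[OF assms, of B l 6 "- 36" 5 1] 3
      by (fastforce dest!: le3 simp: b_def min_zero_sums_def)
  next
    case 4
    show ?thesis
      using zero_sums_plane_bound[OF assms, of B l 7 "- 59" 6 1] 4
      by (fastforce dest!: le3 simp: b_def min_zero_sums_def)
  next
    case 5
    show ?thesis
      using zero_sums_plane_bound[OF assms, of B l 8 "- 70" 6 1] 5
      by (fastforce dest!: le3 simp: b_def min_zero_sums_def)
  next
    case 6
    show ?thesis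
      using zero_sums_plane_bound[OF assms, of B l 9 81 0 1] 6
      by (fastforce dest!: le3 simp: b_def min_zero_sums_def)
  qed
qed

section \<open>Lines in the space\<close>

lemma nat_le_9_cases:
  "s \<le> 9 \<Longrightarrow> s = 0 \<or> s = 1 \<or> s = 2 \<or> s = 3 \<or> s = 4 \<or> s = 5 \<or> s = 6 \<or> s = 7 \<or> s = 8 \<or> s = 9"
  for s :: nat
  by presburger

lemma min_zero_sums_simps:
  "min_zero_sums 0 = 0" "min_zero_sums 1 = 1" "min_zero_sums (Suc 0) = 1" "min_zero_sums 2 = 2"
  "min_zero_sums 3 = 3" "min_zero_sums 4 = 4" "min_zero_sums 5 = 11" "min_zero_sums 6 = 18"
  "min_zero_sums 7 = 37" "min_zero_sums 8 = 56" "min_zero_sums 9 = 81"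
  by (simp_all add: min_zero_sums_def)

text \<open>The straight line through the table values at 6, 7 and 8.\<close>

lemma min_zero_sums_ge_linear: "s \<le> 9 \<Longrightarrow> 19 * int s - 96 \<le> min_zero_sums s"
  by (drule nat_le_9_cases) (elim disjE; simp add: min_zero_sums_simps)

text \<open>The averaging argument again, with planes in place of lines and 26 nonzero functionals.
  The moments are exact, so \<gamma> and \<delta> may have any sign; the table is only a lower
  bound, hence \<open>m \<ge> 0\<close>.\<close>

lemma zero_sums_space_bound:
  fixes B :: "F33 set" and a :: int
  assumes a: "int (card B) = a" and m: "m \<ge> 0"
    and bound: "\<And>s0 s1 s2. s0 \<le> 9 \<Longrightarrow> s1 \<le> 9 \<Longrightarrow> s2 \<le> 9 \<Longrightarrow> s0 + s1 + s2 = card B \<Longrightarrow>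
      \<alpha> + \<gamma> * (int s0 ^ 2 + int s1 ^ 2 + int s2 ^ 2) + \<delta> * (int s0 ^ 3 + int s1 ^ 3 + int s2 ^ 3)
        \<le> m * (min_zero_sums s0 + min_zero_sums s1 + min_zero_sums s2)"
  shows "26 * \<alpha> + \<gamma> * (8 * a ^ 2 + 18 * a)
      + \<delta> * (2 * a ^ 3 + 18 * a ^ 2 + 6 * int (card (zero_sums B)))
    \<le> m * (8 * int (card (zero_sums B)) + 18 * a)"
proof -
  let ?S = "\<lambda>j c. \<Sum>k\<in>UNIV. int (card (slice B c k)) ^ j"
  let ?T = "\<lambda>c. \<Sum>k\<in>UNIV. int (card (zero_sums (slice B c k)))"
  have 0: "slice B 0 k = (if k = 0 then B else {})" for k
    by (auto simp: slice_def dot_zero)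
  have "?S j 0 = a ^ j" if "j > 0" for j
  proof -
    have "int (card (slice B 0 k)) ^ j = (if k = 0 then a ^ j else 0)" for k
      using that a by (simp add: 0)
    then show ?thesis by simp
  qed
  then have S: "(\<Sum>c\<in>UNIV. ?S j c) = a ^ j + (\<Sum>c\<in>- {0}. ?S j c)" if "j > 0" for j
    using that by (simp add: sum.remove[of UNIV 0] Compl_eq_Diff_UNIV)
  have "?T 0 = int (card (zero_sums B))"
  proof -
    have "int (card (zero_sums (slice B 0 k))) = (if k = 0 then int (card (zero_sums B)) else 0)" for k
      by (simp add: 0 zero_sums_def)
    then show ?thesis by simp
  qed
  then have T: "(\<Sum>c\<in>UNIV. ?T c) = int (card (zero_sums B)) + (\<Sum>c\<in>- {0}. ?T c)"
    by (simp add: sum.remove[of UNIV 0] Compl_eq_Diff_UNIV)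
  have "card (- {0 :: F33}) = 26"
    by (simp add: Compl_eq_Diff_UNIV card_Diff_subset)
  then have "26 * \<alpha> + \<gamma> * (\<Sum>c\<in>- {0}. ?S 2 c) + \<delta> * (\<Sum>c\<in>- {0}. ?S 3 c) =
      (\<Sum>c\<in>- {0}. \<alpha> + \<gamma> * ?S 2 c + \<delta> * ?S 3 c)"
    by (simp add: sum.distrib sum_distrib_left)
  also have "\<dots> \<le> (\<Sum>c\<in>- {0}. m * ?T c)"
  proof (rule sum_mono)
    fix c :: F33 assume "c \<in> - {0}"
    then have c: "c \<noteq> 0" by simp
    have "\<alpha> + \<gamma> * ?S 2 c + \<delta> * ?S 3 c \<le> m * (\<Sum>k\<in>UNIV. min_zero_sums (card (slice B c k)))"
      using bound[of "card (slice B c 0)" "card (slice B c 1)" "card (slice B c 2)"] a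
      by (simp only: sum_card_slices sum_3 card_slice_le[OF c])
    also have "\<dots> \<le> m * ?T c"
      by (intro mult_left_mono sum_mono min_zero_sums_le c m)
    finally show "\<alpha> + \<gamma> * ?S 2 c + \<delta> * ?S 3 c \<le> m * ?T c" .
  qed
  also have "\<dots> = m * (\<Sum>c\<in>- {0}. ?T c)"
    by (simp add: sum_distrib_left)
  \<comment> \<open>The functional 0 contributes a^2, a^3 and the size of
    \<open>zero_sums B\<close>; subtracting these from the three sums gives the stated
    coefficients.\<close>
  finally show ?thesis
    using S[of 2] S[of 3] T sum_slice_square[of B] sum_slice_cube[of B] sum_zero_sums_slice[of B] a
    by (simp add: algebra_simps)
qed

text \<open>
  The coefficients below solve the dual of the linear program that minimises the number of lines
  subject to the second and third moment of the sizes of the plane slices.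
\<close>

lemma zero_sums_ge_space:
  fixes B :: "F33 set"
  shows "22 * int (card B) - 240 \<le> int (card (zero_sums B))"
proof -
  define a where "a = card B"
  define T where "T = int (card (zero_sums B))"
  have "a \<le> 27"
    using card_mono[of UNIV B] by (simp add: a_def)
  then consider "a \<le> 12 \<or> a \<ge> 18" | "a = 13" | "a = 14" | "a = 15" | "a = 16" | "a = 17"
    by linarith
  then show ?thesis
  proof cases
    case 1
    \<comment> \<open>A bound for each slice separately, with equality at 0, 1, 4, 6 and 9; over
      three slices the linear terms add up to 9 a.\<close>
    have g: "int s ^ 3 - 5 * int s ^ 2 + 9 * int s \<le> 5 * min_zero_sums s" if "s \<le> 9" for s
      using nat_le_9_cases[OF that] by (elim disjE) (simp_all add: min_zero_sums_simps)
    have "9 * int a + (- 5) * (int s0 ^ 2 + int s1 ^ 2 + int s2 ^ 2)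
          + 1 * (int s0 ^ 3 + int s1 ^ 3 + int s2 ^ 3)
        \<le> 5 * (min_zero_sums s0 + min_zero_sums s1 + min_zero_sums s2)"
      if "s0 \<le> 9" "s1 \<le> 9" "s2 \<le> 9" "s0 + s1 + s2 = card B" for s0 s1 s2
      using g[OF that(1)] g[OF that(2)] g[OF that(3)] by (simp add: a_def flip: that(4))
    then have "26 * (9 * int a) + (- 5) * (8 * int a ^ 2 + 18 * int a)
        + 1 * (2 * int a ^ 3 + 18 * int a ^ 2 + 6 * T) \<le> 5 * (8 * T + 18 * int a)"
      unfolding T_def by (intro zero_sums_space_bound) (simp_all add: a_def)
    then have T: "2 * int a ^ 3 - 22 * int a ^ 2 + 54 * int a \<le> 34 * T"
      by simp
    \<comment> \<open>The product is negative for a = 13, ..., 17, whence the separate cases. The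
      factor a + 19 gives the a^2 coefficient -11 of the cubic bound on 17 T.\<close>
    have "0 \<le> (int a - 12) * (int a - 18) * (int a + 19)"
      using 1 by (subst zero_le_mult_iff) (auto simp: zero_le_mult_iff)
    then have "7 * int a - 24 \<le> 17 * (T - (22 * int a - 240))"
      using T by (simp add: algebra_simps power2_eq_square power3_eq_cube)
    \<comment> \<open>This settles a \<le> 3, where 22 a - 240 is negative; for a \<ge> 4 the
      quantity 7 a - 24 is positive.\<close>
    moreover have "0 \<le> T" by (simp add: T_def)
    ultimately have "22 * int a - 240 \<le> T" by (smt (verit))
    then show ?thesis by (simp add: a_def T_def)
  next
    case 2
    have "235 + (-9) * (int s0 ^ 2 + int s1 ^ 2 + int s2 ^ 2)
          + 2 * (int s0 ^ 3 + int s1 ^ 3 + int s2 ^ 3)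
        \<le> 12 * (min_zero_sums s0 + min_zero_sums s1 + min_zero_sums s2)"
      if "s0 \<le> 9" "s1 \<le> 9" "s2 \<le> 9" "s0 + s1 + s2 = 13" for s0 s1 s2
    proof -
      have s2: "s2 = 13 - s0 - s1" using that(4) by simp
      show ?thesis
        using that(3,4) nat_le_9_cases[OF that(1)] nat_le_9_cases[OF that(2)] unfolding s2
        by (elim disjE; simp add: min_zero_sums_simps)
    qed
    then show ?thesis
      using zero_sums_space_bound[of B 13 12 235 "- 9" 2] 2 by (simp add: a_def)
  next
    case 3
    have "(-2470) + 60 * (int s0 ^ 2 + int s1 ^ 2 + int s2 ^ 2)
          + (-4) * (int s0 ^ 3 + int s1 ^ 3 + int s2 ^ 3)
        \<le> 9 * (min_zero_sums s0 + min_zero_sums s1 + min_zero_sums s2)"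
      if "s0 \<le> 9" "s1 \<le> 9" "s2 \<le> 9" "s0 + s1 + s2 = 14" for s0 s1 s2
    proof -
      have s2: "s2 = 14 - s0 - s1" using that(4) by simp
      show ?thesis
        using that(3,4) nat_le_9_cases[OF that(1)] nat_le_9_cases[OF that(2)] unfolding s2
        by (elim disjE; simp add: min_zero_sums_simps)
    qed
    then show ?thesis
      using zero_sums_space_bound[of B 14 9 "- 2470" 60 "- 4"] 3 by (simp add: a_def)
  next
    case 4
    have "(-1401) + 30 * (int s0 ^ 2 + int s1 ^ 2 + int s2 ^ 2)
          + (-2) * (int s0 ^ 3 + int s1 ^ 3 + int s2 ^ 3)
        \<le> 3 * (min_zero_sums s0 + min_zero_sums s1 + min_zero_sums s2)"
      if "s0 \<le> 9" "s1 \<le> 9" "s2 \<le> 9" "s0 + s1 + s2 = 15" for s0 s1 s2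
    proof -
      have s2: "s2 = 15 - s0 - s1" using that(4) by simp
      show ?thesis
        using that(3,4) nat_le_9_cases[OF that(1)] nat_le_9_cases[OF that(2)] unfolding s2
        by (elim disjE; simp add: min_zero_sums_simps)
    qed
    then show ?thesis
      using zero_sums_space_bound[of B 15 3 "- 1401" 30 "- 2"] 4 by (simp add: a_def)
  next
    case 5
    \<comment> \<open>Averaging yields 14 T \<ge> 1568, which is exactly T \<ge> 112 = 22 * 16 -
      240.\<close>
    have "(-784) + 15 * (int s0 ^ 2 + int s1 ^ 2 + int s2 ^ 2)
          + (-1) * (int s0 ^ 3 + int s1 ^ 3 + int s2 ^ 3)
        \<le> 1 * (min_zero_sums s0 + min_zero_sums s1 + min_zero_sums s2)"
      if "s0 \<le> 9" "s1 \<le> 9" "s2 \<le> 9" "s0 + s1 + s2 = 16" for s0 s1 s2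
    proof -
      have s2: "s2 = 16 - s0 - s1" using that(4) by simp
      show ?thesis
        using that(3,4) nat_le_9_cases[OF that(1)] nat_le_9_cases[OF that(2)] unfolding s2
        by (elim disjE; simp add: min_zero_sums_simps)
    qed
    then show ?thesis
      using zero_sums_space_bound[of B 16 1 "- 784" 15 "- 1"] 5 by (simp add: a_def)
  next
    case 6
    have "16 + (-3) * (int s0 ^ 2 + int s1 ^ 2 + int s2 ^ 2)
          + 1 * (int s0 ^ 3 + int s1 ^ 3 + int s2 ^ 3)
        \<le> 6 * (min_zero_sums s0 + min_zero_sums s1 + min_zero_sums s2)"
      if "s0 \<le> 9" "s1 \<le> 9" "s2 \<le> 9" "s0 + s1 + s2 = 17" for s0 s1 s2
    proof -
      have s2: "s2 = 17 - s0 - s1" using that(4) by simp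
      show ?thesis
        using that(3,4) nat_le_9_cases[OF that(1)] nat_le_9_cases[OF that(2)] unfolding s2
        by (elim disjE; simp add: min_zero_sums_simps)
    qed
    then show ?thesis
      using zero_sums_space_bound[of B 17 6 16 "- 3" 1] 6 by (simp add: a_def)
  qed
qed

section \<open>Upper bounds\<close>

text \<open>A line is contained in at most one of the sets \<open>C `` {x}\<close>.\<close>

lemma line_free_zero_sums:
  fixes C :: "('x::finite \<times> 'p::{finite, ab_group_add}) set"
  assumes triple: "\<And>x :: 'p. x + x + x = 0" and "line_free C"
    and bound: "\<And>B :: 'p set. \<alpha> * int (card B) - \<beta> \<le> int (card (zero_sums B))"
  shows "(\<alpha> - 1) * int (card C) \<le> \<beta> * int CARD('x) + int CARD('p) ^ 2 - int CARD('p)"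
proof -
  \<comment> \<open>Ordered pairs of distinct points spanning a line inside the fibre over
    \<open>x\<close>. Over different \<open>x\<close> they are disjoint, so all together they number
    at most the off-diagonal pairs.\<close>
  define N where "N x = {(p, q) \<in> zero_sums (C `` {x}). p \<noteq> q}" for x
  have card_C: "card C = (\<Sum>x\<in>UNIV. card (C `` {x}))"
  proof -
    have "C = Sigma UNIV (\<lambda>x. C `` {x})" by auto
    then show ?thesis by (metis card_SigmaI finite)
  qed
  have split: "card (zero_sums (C `` {x})) = card (C `` {x}) + card (N x)" for x
  proof -
    have "(p, p) \<in> zero_sums (C `` {x}) \<longleftrightarrow> p \<in> C `` {x}" for p
      using minus_double[OF triple, of p] by (simp add: zero_sums_def)
    then have "zero_sums (C `` {x}) = (\<lambda>p. (p, p)) ` (C `` {x}) \<union> N x"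
      by (fastforce simp: N_def)
    moreover have "card ((\<lambda>p. (p, p)) ` (C `` {x})) = card (C `` {x})"
      by (rule card_image) (simp add: inj_on_def)
    moreover have "(\<lambda>p. (p, p)) ` (C `` {x}) \<inter> N x = {}"
      by (auto simp: N_def)
    ultimately show ?thesis by (simp add: card_Un_disjoint)
  qed
  have "N x \<inter> N y = {}" if "x \<noteq> y" for x y
  proof (rule ccontr)
    assume "N x \<inter> N y \<noteq> {}"
    then obtain p q where "(p, q) \<in> N x" "(p, q) \<in> N y" by fast
    then have "p \<noteq> q" "{x, y} \<times> {p, q, - p - q} \<subseteq> C"
      by (auto simp: N_def zero_sums_def)
    with that assms(2) show False unfolding line_free_def by blast
  qed
  then have "(\<Sum>x\<in>UNIV. card (N x)) = card (\<Union>x. N x)"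
    by (subst card_UN_disjoint) auto
  also have "\<dots> \<le> card (- range (\<lambda>p :: 'p. (p, p)))"
    by (rule card_mono) (auto simp: N_def)
  also have "\<dots> = CARD('p) ^ 2 - CARD('p)"
    by (simp add: Compl_eq_Diff_UNIV card_Diff_subset card_image inj_on_def power2_eq_square)
  finally have "int (\<Sum>x\<in>UNIV. card (N x)) \<le> int (CARD('p) ^ 2 - CARD('p))"
    by (rule zle_int[THEN iffD2])
  also have "\<dots> = int CARD('p) ^ 2 - int CARD('p)"
    by (subst of_nat_diff) (simp_all add: power2_nat_le_imp_le self_le_power)
  finally have N: "int (\<Sum>x\<in>UNIV. card (N x)) \<le> int CARD('p) ^ 2 - int CARD('p)" .
  have "\<alpha> * int (card C) - \<beta> * int CARD('x) = (\<Sum>x\<in>UNIV. \<alpha> * int (card (C `` {x})) - \<beta>)"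
    by (simp add: card_C sum_subtractf sum_distrib_left)
  also have "\<dots> \<le> (\<Sum>x\<in>UNIV. int (card (zero_sums (C `` {x}))))"
    by (rule sum_mono) (rule bound)
  also have "\<dots> = int (card C) + int (\<Sum>x\<in>UNIV. card (N x))"
    by (simp add: split card_C sum.distrib)
  finally show ?thesis using N by (simp add: algebra_simps)
qed

text \<open>Equality holds at 2 points, with only constant triples, and at 3 points, where all 9
  pairs count.\<close>

lemma zero_sums_ge_line:
  fixes B :: "3 set"
  shows "7 * int (card B) - 12 \<le> int (card (zero_sums B))"
proof (cases "card B = 3")
  case True
  then have "B = UNIV" by (intro card_subset_eq) simp_all
  then show ?thesis by (simp add: zero_sums_def)
next
  case False
  have "card B \<le> 3" using card_mono[of UNIV B] by simp
  with False have "card B \<le> 2" by simp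
  then show ?thesis using card_le_zero_sums[OF triple_3, of B] by simp
qed

text \<open>Embedded as the plane of first coordinate 0, the set is its own slice, so the table for
  planes applies.\<close>

lemma zero_sums_ge_plane:
  fixes B :: "(3 \<times> 3) set"
  shows "19 * int (card B) - 96 \<le> int (card (zero_sums B))"
proof -
  define f :: "3 \<times> 3 \<Rightarrow> F33" where "f = Pair 0"
  have inj: "inj_on f A" for A by (simp add: f_def inj_on_def)
  have f_diff: "f (- p - q) = - f p - f q" for p q
    by (simp add: f_def)
  have mem: "f x \<in> f ` B \<longleftrightarrow> x \<in> B" for x
    using inj_image_mem_iff[OF inj[of UNIV]] by simp
  have "zero_sums (f ` B) = map_prod f f ` zero_sums B"
  proof (intro equalityI subsetI)
    fix x assume "x \<in> zero_sums (f ` B)"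
    then obtain p q where x: "x = (f p, f q)" "p \<in> B" "q \<in> B" "- f p - f q \<in> f ` B"
      unfolding zero_sums_def by blast
    then have "(p, q) \<in> zero_sums B"
      by (simp add: zero_sums_def mem flip: f_diff)
    then show "x \<in> map_prod f f ` zero_sums B" using x by force
  next
    fix x assume "x \<in> map_prod f f ` zero_sums B"
    then obtain p q where "x = (f p, f q)" "(p, q) \<in> zero_sums B" by auto
    then show "x \<in> zero_sums (f ` B)"
      by (simp add: zero_sums_def mem flip: f_diff)
  qed
  moreover have "inj_on (map_prod f f) (zero_sums B)"
    by (auto simp: inj_on_def f_def)
  ultimately have T: "card (zero_sums (f ` B)) = card (zero_sums B)"
    by (simp add: card_image)
  have slice: "slice (f ` B) (1, 0, 0) 0 = f ` B"
    by (auto simp: slice_def f_def)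
  have nz: "(1, 0, 0) \<noteq> (0 :: F33)" by (simp add: zero_prod_def)
  have "card B \<le> 9" using card_mono[of UNIV B] by simp
  then have "19 * int (card B) - 96 \<le> min_zero_sums (card B)"
    by (rule min_zero_sums_ge_linear)
  also have "\<dots> \<le> int (card (zero_sums B))"
    using min_zero_sums_le[OF nz, of "f ` B" 0] by (simp add: slice T card_image inj)
  finally show ?thesis .
qed

section \<open>The instances n = 1, 2, 3\<close>

interpretation dim1: Z6_split 1 "\<lambda>u. odd (u 0)" "\<lambda>u. of_int (u 0) :: 3"
  by unfold_locales (auto simp: of_int_3)

interpretation dim2: Z6_split 2 "\<lambda>u. (odd (u 0), odd (u 1))"
  "\<lambda>u. (of_int (u 0), of_int (u 1)) :: 3 \<times> 3"
  by unfold_locales (auto simp: of_int_3 All_less_Suc numeral_eq_Suc)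

interpretation dim3: Z6_split 3 "\<lambda>u. (odd (u 0), odd (u 1), odd (u 2))"
  "\<lambda>u. (of_int (u 0), of_int (u 1), of_int (u 2)) :: F33"
  by unfold_locales (auto simp: of_int_3 All_less_Suc numeral_eq_Suc)

lemma max_ap_free_1_le: "max_ap_free 6 6 1 \<le> 5"
proof (rule dim1.max_ap_free_le)
  fix C :: "(bool \<times> 3) set" assume "line_free C"
  \<comment> \<open>The inequality is 6 * card C \<le> 2 * 12 + 6 = 30.\<close>
  from line_free_zero_sums[OF triple_3 this zero_sums_ge_line] show "card C \<le> 5" by simp
qed

lemma max_ap_free_2_le: "max_ap_free 6 6 2 \<le> 25"
proof (rule dim2.max_ap_free_le)
  fix C :: "((bool \<times> bool) \<times> 3 \<times> 3) set" assume C: "line_free C"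
  have "x + x + x = (0 :: 3 \<times> 3)" for x
    by (cases x) (simp only: add_Pair triple_3 zero_prod_def)
  \<comment> \<open>The inequality is 18 * card C \<le> 4 * 96 + 72 = 456, rounded down.\<close>
  from line_free_zero_sums[OF this C zero_sums_ge_plane] show "card C \<le> 25" by simp
qed

lemma max_ap_free_3_le: "max_ap_free 6 6 3 \<le> 124"
proof (rule dim3.max_ap_free_le)
  fix C :: "((bool \<times> bool \<times> bool) \<times> F33) set" assume "line_free C"
  \<comment> \<open>The inequality is 21 * card C \<le> 8 * 240 + 702 = 2622, rounded down.\<close>
  from line_free_zero_sums[OF triple_F33 this zero_sums_ge_space] show "card C \<le> 124" by simp
qed

section \<open>Constructions\<close>

text \<open>Bit \<open>code x\<close> of the number \<open>M p\<close> records whether \<open>(x, p)\<close> belongs to the set.\<close>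

definition mask_set :: "('x \<Rightarrow> nat) \<Rightarrow> ('p \<Rightarrow> int) \<Rightarrow> ('x \<times> 'p) set" where
  "mask_set code M = {(x, p). bit (M p) (code x)}"

text \<open>The conjunction of the three masks on a line records the \<open>x\<close> whose fibre
  contains it; 0 or a power of two means at most one such \<open>x\<close>.\<close>

lemma line_free_mask_set:
  fixes M :: "'p::ab_group_add \<Rightarrow> int"
  assumes "inj code"
    and M: "\<And>p q. p \<noteq> q \<Longrightarrow> and (M p) (and (M q) (M (- p - q))) = 0 \<or> (\<exists>k. and (M p) (and (M q) (M (- p - q))) = 2 ^ k)"
  shows "line_free (mask_set code M)"
  unfolding line_free_def
proof (intro allI impI notI)
  fix x y p q
  assume xy: "x \<noteq> y" and "p \<noteq> q" and sub: "{x, y} \<times> {p, q, - p - q} \<subseteq> mask_set code M"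
  define w where "w = and (M p) (and (M q) (M (- p - q)))"
  have "bit w (code x)" "bit w (code y)"
    using sub by (auto simp: mask_set_def w_def bit_and_iff)
  moreover have "w = 0 \<or> (\<exists>k. w = 2 ^ k)"
    using M[OF \<open>p \<noteq> q\<close>] by (simp add: w_def)
  ultimately have "code x = code y"
    by (auto simp: bit_exp_iff)
  then show False using \<open>inj code\<close> xy by (simp add: inj_eq)
qed

lemma card_mask_set:
  fixes M :: "'p::finite \<Rightarrow> int" and code :: "'x::finite \<Rightarrow> nat"
  shows "card (mask_set code M) = (\<Sum>x\<in>UNIV. \<Sum>p\<in>UNIV. of_bool (bit (M p) (code x)))"
proof -
  have "mask_set code M = Sigma UNIV (\<lambda>x. {p. bit (M p) (code x)})"
    by (auto simp: mask_set_def)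
  then show ?thesis by (simp add: sum_of_bool_eq)
qed

section \<open>Explicit sets in dimensions two and three\<close>

definition third :: "3 \<Rightarrow> 3 \<Rightarrow> 3" where
  "third a b = - a - b"

lemma third_simps:
  "third 0 0 = 0" "third 0 1 = 2" "third 0 2 = 1" "third 1 0 = 2" "third 1 1 = 1"
  "third 1 2 = 0" "third 2 0 = 1" "third 2 1 = 0" "third 2 2 = 2"
  by (simp_all add: third_def)

definition digit :: "3 \<Rightarrow> nat" where
  "digit a = (if a = 0 then 0 else if a = 1 then 1 else 2)"

lemma digit_simps: "digit 0 = 0" "digit 1 = 1" "digit 2 = 2"
  by (simp_all add: digit_def)

text \<open>Both tables were found by simulated annealing.\<close>

definition mask2 :: "3 \<times> 3 \<Rightarrow> int" where
  "mask2 = (\<lambda>(a, b). [[13, 13, 2], [7, 14, 11], [14, 7, 11]] ! digit a ! digit b)"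

definition mask3 :: "F33 \<Rightarrow> int" where
  "mask3 = (\<lambda>(a, b, c).
    [[[39, 141, 170], [122, 150, 181], [121, 210, 155]],
     [[92, 87, 187], [226, 28, 195], [228, 75, 228]],
     [[55, 94, 113], [169, 204, 102], [172, 209, 46]]] ! digit c ! digit b ! digit a)"

definition code2 :: "bool \<times> bool \<Rightarrow> nat" where
  "code2 = (\<lambda>(a, b). of_bool a + 2 * of_bool b)"

definition code3 :: "bool \<times> bool \<times> bool \<Rightarrow> nat" where
  "code3 = (\<lambda>(a, b, c). of_bool a + 2 * of_bool b + 4 * of_bool c)"

text \<open>Only the bits 0 to 3 code points of (Z/2)^2, so the existential becomes a finite
  disjunction and the claim a computation over all pairs.\<close>

lemma mask2_lines: "\<forall>p1 p2 q1 q2. (p1, p2) \<noteq> (q1, q2) \<longrightarrow>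
  (let w = and (mask2 (p1, p2)) (and (mask2 (q1, q2)) (mask2 (third p1 q1, third p2 q2)))
   in w = 0 \<or> (\<exists>k\<in>{0, 1, 2, 3}. w = 2 ^ k))"
  unfolding all_3 third_simps mask2_def prod.case digit_simps
  by (simp add: Let_def)

lemma mask3_lines: "\<forall>p1 p2 p3 q1 q2 q3. (p1, p2, p3) \<noteq> (q1, q2, q3) \<longrightarrow>
  (let w = and (mask3 (p1, p2, p3))
      (and (mask3 (q1, q2, q3)) (mask3 (third p1 q1, third p2 q2, third p3 q3)))
   in w = 0 \<or> (\<exists>k\<in>{0, 1, 2, 3, 4, 5, 6, 7}. w = 2 ^ k))"
  unfolding all_3 third_simps mask3_def prod.case digit_simps
  by (simp add: Let_def)

lemma line_free_mask2: "line_free (mask_set code2 mask2)"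
proof (rule line_free_mask_set)
  show "inj code2"
    by (auto simp: inj_def code2_def)
  fix p q :: "3 \<times> 3" assume pq: "p \<noteq> q"
  obtain p1 p2 where p: "p = (p1, p2)" by (cases p)
  obtain q1 q2 where q: "q = (q1, q2)" by (cases q)
  have "- p - q = (third p1 q1, third p2 q2)"
    by (simp add: p q third_def)
  then show "and (mask2 p) (and (mask2 q) (mask2 (- p - q))) = 0 \<or>
      (\<exists>k. and (mask2 p) (and (mask2 q) (mask2 (- p - q))) = 2 ^ k)"
    using mask2_lines[rule_format, of p1 p2 q1 q2] pq unfolding p q Let_def by metis
qed

lemma line_free_mask3: "line_free (mask_set code3 mask3)"
proof (rule line_free_mask_set)
  show "inj code3"
    by (auto simp: inj_def code3_def)
  fix p q :: F33 assume pq: "p \<noteq> q"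
  obtain p1 p2 p3 where p: "p = (p1, p2, p3)" by (cases p)
  obtain q1 q2 q3 where q: "q = (q1, q2, q3)" by (cases q)
  have "- p - q = (third p1 q1, third p2 q2, third p3 q3)"
    by (simp add: p q third_def)
  then show "and (mask3 p) (and (mask3 q) (mask3 (- p - q))) = 0 \<or>
      (\<exists>k. and (mask3 p) (and (mask3 q) (mask3 (- p - q))) = 2 ^ k)"
    using mask3_lines[rule_format, of p1 p2 p3 q1 q2 q3] pq unfolding p q Let_def by metis
qed

lemma card_mask2: "card (mask_set code2 mask2) = 25"
  unfolding card_mask_set sum_UNIV_prod sum_3 UNIV_bool mask2_def code2_def prod.case digit_simps
  by (simp add: bit_numeral_rec)

lemma card_mask3: "card (mask_set code3 mask3) = 116"
  unfolding card_mask_set sum_UNIV_prod sum_3 UNIV_bool mask3_def code3_def prod.case digit_simps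
  by (simp add: bit_numeral_rec)

text \<open>The only line of Z/3 is the whole group, and the fibre over \<open>True\<close> misses a
  point of it.\<close>

lemma line_free_compl_singleton: "line_free (- {(True, 0 :: 3)})"
proof -
  have "\<forall>p q :: 3. p \<noteq> q \<longrightarrow> p = 0 \<or> q = 0 \<or> - p - q = 0"
    unfolding all_3 by simp
  then show ?thesis unfolding line_free_def by auto
qed

lemma card_compl_singleton: "card (- {(True, 0 :: 3)}) = 5"
  by (simp add: Compl_eq_Diff_UNIV card_Diff_subset)

theorem theorem1p1:
  shows "max_ap_free 6 6 1 = 5 \<and> max_ap_free 6 6 2 = 25 \<and>
    116 \<le> max_ap_free 6 6 3 \<and> max_ap_free 6 6 3 \<le> 124"
  using max_ap_free_1_le max_ap_free_2_le max_ap_free_3_le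
    dim1.max_ap_free_ge[OF line_free_compl_singleton] dim2.max_ap_free_ge[OF line_free_mask2]
    dim3.max_ap_free_ge[OF line_free_mask3]
  by (simp add: card_compl_singleton card_mask2 card_mask3)

end
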